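(* For every integer $n\geq 2$ we have $b_n\neq 3$.
   Context: The sequence $(a_n)_{n\ge 1}$ of positive integers is defined by $a_1=1$ and $a_n=a_{n-1}+\operatorname{lcm}(n,a_{n-1})$ for $n\geq 2$. Each $a_{n}$ is a multiple of $a_{n-1}$, and one sets $b_n=\frac{a_n}{a_{n-1}}-1$ for $n\geq 2$, which is a positive integer. *)

theory Defs
  imports Complex_Main
begin

(* The sequence starts at index 1; the value at index 0 is a dummy and is not used by later values. *)
fun a :: "nat \<Rightarrow> nat" where
  "a 0 = 0"
| "a (Suc 0) = 1"
| "a (Suc (Suc n)) = a (Suc n) + lcm (Suc (Suc n)) (a (Suc n))"

(* Meaningful for n >= 2 only. The quotient is taken in the rationals, so that neither div nor
   truncated subtraction is involved; b_pos_integer shows that the value is a positive integer. *)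
definition b :: "nat \<Rightarrow> rat" where
  "b n = of_nat (a n) / of_nat (a (n - 1)) - 1"

lemma a_rec: "n \<ge> 2 \<Longrightarrow> a n = a (n - 1) + lcm n (a (n - 1))"
  by (cases n rule: a.cases) auto

lemma a_pos: "n \<ge> 1 \<Longrightarrow> a n > 0"
  by (induction n rule: a.induct) auto

lemma a_dvd: "n \<ge> 2 \<Longrightarrow> a (n - 1) dvd a n"
  by (subst a_rec) auto

lemma b_pos_integer:
  assumes "n \<ge> 2"
  shows "\<exists>k::nat. k > 0 \<and> b n = of_nat k"
proof -
  have pos: "a (n - 1) > 0" using assms by (intro a_pos) simp
  obtain k where k: "lcm n (a (n - 1)) = a (n - 1) * k" by (meson dvdE dvd_lcm2)
  have "k > 0" using k pos assms by (cases "k = 0") auto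
  moreover have "b n = of_nat k"
    unfolding b_def a_rec[OF assms] k using pos by (simp add: field_simps)
  ultimately show ?thesis by blast
qed

end

theory Submission
  imports Defs "HOL-Computational_Algebra.Primes"
begin

text \<open>
  Since \<open>lcm n a = a * n / gcd n a\<close>, the number \<open>b n\<close> equals \<open>n / gcd n (a (n - 1))\<close>.  If it
  were 3, then \<open>a (n - 1)\<close> would contain the prime 3 exactly one time less often than \<open>n\<close> does. So it
  suffices that \<open>3 ^ k\<close> divides \<open>a (n - 1)\<close> whenever \<open>3 ^ k \<le> n\<close>.

  The factors 3 come from primes. A prime \<open>p \<ge> 5\<close> divides no \<open>a m\<close> with \<open>m < p\<close>
  (\<open>prime_not_dvd_a\<close>), hence \<open>b p = p\<close> and \<open>a p = (p + 1) * a (p - 1)\<close>; if \<open>p\<close> is 2 modulo 3, this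
  step contributes a factor 3. The same holds for \<open>p = 2\<close>. Therefore \<open>a m\<close> is divisible by \<open>3 ^ r\<close>,
  where \<open>r\<close> is the number of primes up to \<open>m\<close> that are 2 modulo 3 (\<open>three_power_dvd_a\<close>). It
  remains to see that this number is at least \<open>k\<close> for \<open>m = n - 1\<close> and \<open>3 ^ k \<le> n\<close>
  (\<open>card_primes_2_mod_3_ge_log3\<close>).

  This logarithmic bound is far weaker than the prime number theorem for arithmetic progressions, and a Chebyshev
  argument gives it. Compare \<open>A\<close>, the product of \<open>3 * m + 2\<close> over \<open>m < N\<close>, with \<open>B\<close>, the product
  of \<open>3 * m + 1\<close>. Put \<open>x = 3 * N\<close>. A prime that is 1 modulo 3 divides \<open>B\<close> at least as often as \<open>A\<close>,
  and once more if it lies between \<open>x / 2\<close> and \<open>x\<close>. A prime that is 2 modulo 3 can prefer \<open>A\<close>, but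
  only by a power of at most \<open>x\<close>. As \<open>B \<le> A\<close>, the product of the primes of the first kind between
  \<open>x / 2\<close> and \<open>x\<close> is at most \<open>x ^ r\<close> (\<open>prod_primes_1_mod_3_upper_half_le\<close>). Summing over dyadic
  intervals, few primes that are 2 modulo 3 would force few primes that are 1 modulo 3, so few
  primes altogether, against Chebyshev's lower bound from the central binomial coefficient
  (\<open>four_power_le_power_card_primes\<close>).
\<close>

section \<open>Prime powers in quotients of products\<close>

lemma multiplicity_eq_card_powers:
  fixes x p :: nat
  assumes "prime p" "0 < x" "x < p ^ Suc J"
  shows "multiplicity p x = card {j \<in> {1..J}. p ^ j dvd x}"
proof -
  have nu: "\<not> is_unit p" using assms(1) by auto
  have dv: "p ^ j dvd x \<longleftrightarrow> j \<le> multiplicity p x" for j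
    using power_dvd_iff_le_multiplicity[of x p j] nu assms(2) by auto
  have "\<not> p ^ Suc J dvd x"
    using assms by (metis dvd_imp_le not_le)
  then have "multiplicity p x \<le> J" using dv[of "Suc J"] by linarith
  then have "{j \<in> {1..J}. p ^ j dvd x} = {1..multiplicity p x}" unfolding dv by auto
  then show ?thesis by simp
qed

lemma multiplicity_prod_eq_sum_card:
  fixes f :: "'i \<Rightarrow> nat"
  assumes p: "prime p" and S: "finite S"
    and f: "\<And>m. m \<in> S \<Longrightarrow> 0 < f m" "\<And>m. m \<in> S \<Longrightarrow> f m < p ^ Suc J"
  shows "multiplicity p (\<Prod>m\<in>S. f m) = (\<Sum>j=1..J. card {m \<in> S. p ^ j dvd f m})"
proof -
  have "multiplicity p (\<Prod>m\<in>S. f m) = (\<Sum>m\<in>S. multiplicity p (f m))"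
    using f(1) by (intro prime_elem_multiplicity_prod_distrib prime_imp_prime_elem p S) force
  also have "\<dots> = (\<Sum>m\<in>S. card {j \<in> {1..J}. p ^ j dvd f m})"
    by (intro sum.cong refl multiplicity_eq_card_powers p f)
  also have "\<dots> = (\<Sum>j=1..J. card {m \<in> S. p ^ j dvd f m})"
    by (intro sum_multicount_gen S ballI refl) simp
  finally show ?thesis .
qed

text \<open>
  With \<open>p ^ J\<close> the largest power of \<open>p\<close> up to \<open>X\<close>, only the exponents from 1 to \<open>J\<close> count, and each of
  them gives the first product an advantage of at most one factor \<open>p\<close>. Both prime number
  estimates below rest on this: one compares \<open>(2 n)!\<close> with \<open>n! n!\<close>, the other compares
  the products over two residue classes.
\<close>

lemma prime_power_excess_le:
  fixes f :: "'i \<Rightarrow> nat" and g :: "'j \<Rightarrow> nat"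
  assumes p: "prime p" and fin: "finite S" "finite T" and X: "0 < X"
    and f: "\<And>m. m \<in> S \<Longrightarrow> 0 < f m \<and> f m \<le> X"
    and g: "\<And>m. m \<in> T \<Longrightarrow> 0 < g m \<and> g m \<le> X"
    and le: "\<And>j. card {m \<in> S. p ^ j dvd f m} \<le> card {m \<in> T. p ^ j dvd g m} + 1"
  shows "p ^ (multiplicity p (\<Prod>m\<in>S. f m) - multiplicity p (\<Prod>m\<in>T. g m)) \<le> X"
proof -
  obtain J where J: "p ^ J \<le> X" "X < p ^ Suc J"
    using ex_power_ivl1[of p X] prime_ge_2_nat[OF p] X by auto
  have f_less: "f m < p ^ Suc J" if "m \<in> S" for m
    using f[OF that] J(2) by linarith
  have g_less: "g m < p ^ Suc J" if "m \<in> T" for m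
    using g[OF that] J(2) by linarith
  have "multiplicity p (\<Prod>m\<in>S. f m) = (\<Sum>j=1..J. card {m \<in> S. p ^ j dvd f m})"
    using f by (intro multiplicity_prod_eq_sum_card[OF p fin(1) _ f_less]) blast+
  also have "\<dots> \<le> (\<Sum>j=1..J. card {m \<in> T. p ^ j dvd g m} + 1)"
    by (rule sum_mono) (rule le)
  also have "\<dots> = (\<Sum>j=1..J. card {m \<in> T. p ^ j dvd g m}) + J"
    unfolding sum.distrib by simp
  also have "(\<Sum>j=1..J. card {m \<in> T. p ^ j dvd g m}) = multiplicity p (\<Prod>m\<in>T. g m)"
    using g by (intro multiplicity_prod_eq_sum_card[OF p fin(2) _ g_less, symmetric]) blast+
  finally have "multiplicity p (\<Prod>m\<in>S. f m) - multiplicity p (\<Prod>m\<in>T. g m) \<le> J" by simp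
  then have "p ^ (multiplicity p (\<Prod>m\<in>S. f m) - multiplicity p (\<Prod>m\<in>T. g m)) \<le> p ^ J"
    using prime_gt_0_nat[OF p] by (intro power_increasing) auto
  with J(1) show ?thesis by simp
qed

section \<open>Chebyshev's lower bound for the number of primes\<close>

lemma card_multiples: "0 < d \<Longrightarrow> card {m \<in> {1..n}. d dvd m} = n div d" for d n :: nat
proof -
  assume d: "0 < d"
  have "{m \<in> {1..n}. d dvd m} = (\<lambda>t. d * t) ` {1..n div d}"
    using d by (auto simp: image_iff dvd_def less_eq_div_iff_mult_less_eq mult.commute)
  then show ?thesis using d by (simp add: card_image inj_on_def)
qed

lemma prime_power_central_binomial_le:
  assumes p: "prime p" and n: "0 < n"
  shows "p ^ multiplicity p ((2 * n) choose n) \<le> 2 * n"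
proof -
  \<comment> \<open>Every number from 1 to \<open>n\<close> twice, so that \<open>n! n!\<close> is a product over one index set.\<close>
  define T where "T = {1..n} \<times> (UNIV :: bool set)"
  have eq: "fact n * fact n * ((2 * n) choose n) = (fact (2 * n) :: nat)"
    using binomial_fact_lemma[of n "2 * n"] by (simp add: mult_2)
  have "(\<Prod>t\<in>T. fst t) = (\<Prod>m\<in>{1..n}. m * m)"
    unfolding T_def by (subst prod.Sigma [symmetric, where g = "\<lambda>m _. m", unfolded split_def])
      (simp_all add: power2_eq_square)
  then have T: "(\<Prod>t\<in>T. fst t) = fact n * fact n"
    by (simp add: prod.distrib fact_prod)
  have "multiplicity p (fact n * fact n * ((2 * n) choose n)) =
        multiplicity p (fact n * fact n :: nat) + multiplicity p ((2 * n) choose n)"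
    using p by (intro prime_elem_multiplicity_mult_distrib) (simp_all add: prime_imp_prime_elem)
  then have v: "multiplicity p ((2 * n) choose n) =
      multiplicity p (\<Prod>m\<in>{1..2*n}. m) - multiplicity p (\<Prod>t\<in>T. fst t)"
    unfolding eq T by (simp add: fact_prod)
  show ?thesis unfolding v
  proof (rule prime_power_excess_le[OF p])
    fix j
    have d: "0 < p ^ j" using prime_gt_0_nat[OF p] by simp
    have "{t \<in> T. p ^ j dvd fst t} = {m \<in> {1..n}. p ^ j dvd m} \<times> UNIV"
      by (auto simp: T_def)
    then have "card {t \<in> T. p ^ j dvd fst t} = 2 * (n div p ^ j)"
      using card_multiples[OF d, of n] by (simp add: card_cartesian_product)
    moreover have "2 * n div p ^ j \<le> 2 * (n div p ^ j) + 1"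
    proof -
      have "n < p ^ j * (n div p ^ j + 1)"
        using d by (simp add: dividend_less_times_div)
      then have "2 * n < (2 * (n div p ^ j) + 2) * p ^ j"
        by (simp add: algebra_simps)
      then have "2 * n div p ^ j < 2 * (n div p ^ j) + 2"
        using d by (simp add: div_less_iff_less_mult)
      then show ?thesis by linarith
    qed
    ultimately show "card {m \<in> {1..2*n}. p ^ j dvd m} \<le> card {t \<in> T. p ^ j dvd fst t} + 1"
      using card_multiples[OF d, of "2*n"] by simp
  qed (use n in \<open>auto simp: T_def\<close>)
qed

text \<open>
  The central binomial coefficient is at least \<open>4 ^ n / (2 n)\<close>, and it is a product of prime
  powers each of which is at most \<open>2 n\<close>.
\<close>

lemma four_power_le_power_card_primes:
  assumes n: "0 < n"
  shows "4 ^ n \<le> (2 * n) ^ (card {p. prime p \<and> p \<le> 2 * n} + 1)"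
proof -
  let ?C = "(2 * n) choose n"
  let ?P = "{p. prime p \<and> p \<le> 2 * n}"
  have C0: "0 < ?C" by simp
  have fin: "finite ?P" by simp
  have "p \<in> ?P" if "p \<in> prime_factors ?C" for p
  proof -
    have "prime p" "p dvd ?C" using that by auto
    then have "multiplicity p ?C \<noteq> 0" using C0
      by (metis multiplicity_eq_zero_iff not_gr_zero not_prime_unit)
    then have "p ^ 1 \<le> p ^ multiplicity p ?C"
      using prime_gt_0_nat[OF \<open>prime p\<close>] by (intro power_increasing) auto
    then show ?thesis using prime_power_central_binomial_le[OF \<open>prime p\<close> n] \<open>prime p\<close> by simp
  qed
  then have sub: "prime_factors ?C \<subseteq> ?P" by blast
  have "?C = (\<Prod>p\<in>prime_factors ?C. p ^ multiplicity p ?C)"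
    by (rule prime_factorization_nat[OF C0])
  also have "\<dots> \<le> (\<Prod>p\<in>prime_factors ?C. 2 * n)"
    using n by (intro prod_mono conjI prime_power_central_binomial_le) auto
  also have "\<dots> = (2 * n) ^ card (prime_factors ?C)" by simp
  also have "\<dots> \<le> (2 * n) ^ card ?P"
    using n by (intro power_increasing card_mono fin sub) auto
  finally have le: "?C \<le> (2 * n) ^ card ?P" .
  have "real (4 ^ n) \<le> real (2 * n * ?C)"
    using central_binomial_lower_bound[OF n] n by (simp add: field_simps)
  then have "4 ^ n \<le> 2 * n * ?C" using of_nat_le_iff by blast
  also have "\<dots> \<le> 2 * n * (2 * n) ^ card ?P" using le by (intro mult_left_mono) auto
  finally show ?thesis by simp
qed

section \<open>Primes in the two residue classes modulo 3\<close>

definition primes_mod3 :: "nat \<Rightarrow> nat \<Rightarrow> nat set" where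
  "primes_mod3 r x = {p. prime p \<and> p \<le> x \<and> p mod 3 = r}"

lemma finite_primes_mod3 [simp]: "finite (primes_mod3 r x)"
  unfolding primes_mod3_def by simp

lemma card_primes_mod3_mono: "x \<le> y \<Longrightarrow> card (primes_mod3 r x) \<le> card (primes_mod3 r y)"
  by (intro card_mono) (auto simp: primes_mod3_def)

lemma prime_mod_3_eq_0: "prime p \<Longrightarrow> p mod 3 = 0 \<Longrightarrow> p = 3" for p :: nat
  using primes_dvd_imp_eq[of 3 p] by auto

lemma card_primes_le:
  "card {p. prime p \<and> p \<le> x} \<le> 1 + card (primes_mod3 1 x) + card (primes_mod3 2 x)"
proof -
  have "p \<in> {3} \<union> (primes_mod3 1 x \<union> primes_mod3 2 x)" if "prime p" "p \<le> x" for p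
  proof -
    consider "p mod 3 = 0" | "p mod 3 = 1" | "p mod 3 = 2" by linarith
    then show ?thesis using that prime_mod_3_eq_0[of p] by cases (simp_all add: primes_mod3_def)
  qed
  then have "{p. prime p \<and> p \<le> x} \<subseteq> {3} \<union> (primes_mod3 1 x \<union> primes_mod3 2 x)"
    by (intro subsetI) simp
  then have "card {p. prime p \<and> p \<le> x} \<le> card ({3} \<union> (primes_mod3 1 x \<union> primes_mod3 2 x))"
    by (intro card_mono) auto
  also have "\<dots> \<le> card {3::nat} + card (primes_mod3 1 x \<union> primes_mod3 2 x)"
    by (rule card_Un_le)
  also have "\<dots> \<le> 1 + card (primes_mod3 1 x) + card (primes_mod3 2 x)"
    using card_Un_le[of "primes_mod3 1 x" "primes_mod3 2 x"] by simp
  finally show ?thesis .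
qed

text \<open>
  Subtracting \<open>d\<close> (if \<open>d\<close> is 1 modulo 3) or \<open>2 d\<close> (if \<open>d\<close> is 2 modulo 3) turns a multiple of \<open>d\<close> in
  the class of 2 into one in the class of 1. In the second case this fails only for the multiple
  \<open>d\<close> itself, which accounts for the additional 1.
\<close>

lemma card_multiples_2_mod_3_le_1_mod_3:
  fixes d N :: nat
  shows "card {m \<in> {..<N}. d dvd 3 * m + 2} \<le> card {m \<in> {..<N}. d dvd 3 * m + 1} + 1"
    and "d mod 3 = 1 \<Longrightarrow>
      card {m \<in> {..<N}. d dvd 3 * m + 2} \<le> card {m \<in> {..<N}. d dvd 3 * m + 1}"
proof -
  let ?A = "{m \<in> {..<N}. d dvd 3 * m + 2}"
  let ?B = "{m \<in> {..<N}. d dvd 3 * m + 1}"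
  have one: "card ?A \<le> card ?B" if d: "d mod 3 = 1"
  proof -
    define e where "e = d div 3"
    have de: "d = 3 * e + 1" using d unfolding e_def by presburger
    have ge: "e \<le> m" if "m \<in> ?A" for m
      using that dvd_imp_le[of d "3 * m + 2"] de by auto
    have "(\<lambda>m. m - e) ` ?A \<subseteq> ?B"
    proof (rule image_subsetI)
      fix m assume m: "m \<in> ?A"
      have "3 * (m - e) + 1 = 3 * m + 2 - d" using ge[OF m] de by simp
      moreover have "d dvd 3 * m + 2 - d" using m by (intro dvd_diff_nat) auto
      ultimately have "d dvd 3 * (m - e) + 1" by metis
      then show "m - e \<in> ?B" using m by auto
    qed
    moreover have "inj_on (\<lambda>m. m - e) ?A"
      using ge by (intro inj_onI) (metis le_add_diff_inverse2)
    ultimately show ?thesis by (intro card_inj_on_le) auto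
  qed
  have two: "card ?A \<le> card ?B + 1" if d: "d mod 3 = 2"
  proof -
    define e where "e = (2 * d) div 3"
    have de: "2 * d = 3 * e + 1" using d unfolding e_def by presburger
    \<comment> \<open>The index with \<open>3 * m + 2 = d\<close> has no image.\<close>
    define A' where "A' = ?A - {(d - 2) div 3}"
    have ge: "e \<le> m" if m: "m \<in> A'" for m
    proof -
      from m have "d dvd 3 * m + 2" by (auto simp: A'_def)
      then obtain t where t: "3 * m + 2 = d * t" by (elim dvdE)
      have "t \<noteq> 0" using t by (intro notI) simp
      moreover have "t \<noteq> 1"
      proof
        assume "t = 1"
        then have "m = (d - 2) div 3" using t by simp
        then show False using m by (simp add: A'_def)
      qed
      ultimately have "d * 2 \<le> d * t" by (intro mult_le_mono2) linarith
      then show ?thesis using t de by linarith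
    qed
    have "(\<lambda>m. m - e) ` A' \<subseteq> ?B"
    proof (rule image_subsetI)
      fix m assume m: "m \<in> A'"
      have "3 * (m - e) + 1 = 3 * m + 2 - 2 * d" using ge[OF m] de by simp
      moreover have "d dvd 3 * m + 2 - 2 * d"
        using m by (intro dvd_diff_nat) (auto simp: A'_def)
      ultimately have "d dvd 3 * (m - e) + 1" by metis
      then show "m - e \<in> ?B" using m by (auto simp: A'_def)
    qed
    moreover have "inj_on (\<lambda>m. m - e) A'"
      using ge by (intro inj_onI) (metis le_add_diff_inverse2)
    ultimately have "card A' \<le> card ?B" by (intro card_inj_on_le) auto
    moreover have "card ?A \<le> card (insert ((d - 2) div 3) A')"
      by (intro card_mono) (auto simp: A'_def)
    moreover have "card (insert ((d - 2) div 3) A') \<le> card A' + 1"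
      unfolding A'_def by (subst card_insert_disjoint) auto
    ultimately show ?thesis by linarith
  qed
  have zero: "card ?A \<le> card ?B" if d: "d mod 3 = 0"
  proof -
    have "3 dvd d" using d by auto
    have "\<not> d dvd 3 * m + 2" for m
    proof
      assume "d dvd 3 * m + 2"
      with \<open>3 dvd d\<close> have "3 dvd 3 * m + 2" by (rule dvd_trans)
      then show False by presburger
    qed
    then show ?thesis by simp
  qed
  have "d mod 3 = 0 \<or> d mod 3 = 1 \<or> d mod 3 = 2" by presburger
  then show "card ?A \<le> card ?B + 1" using zero one two by (elim disjE) simp_all
  show "d mod 3 = 1 \<Longrightarrow> card ?A \<le> card ?B" by (rule one)
qed

text \<open>
  In the notation of the introduction, \<open>A\<close> times the product of the primes in question divides \<open>B\<close>
  times the prime powers by which \<open>A\<close> exceeds \<open>B\<close>; these belong to primes that are 2 modulo 3 and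
  are at most \<open>3 * N\<close>. The multiplicities are compared prime by prime, and \<open>B \<le> A\<close> finishes the
  argument. A prime \<open>p\<close> in the upper half that is 1 modulo 3 divides \<open>B\<close> because it is one of the
  factors, and does not divide \<open>A\<close> because \<open>2 * p\<close> is already too large.
\<close>

lemma prod_primes_1_mod_3_upper_half_le:
  assumes N: "0 < N"
  shows "(\<Prod>p\<in>{p \<in> primes_mod3 1 (3 * N). 3 * N < 2 * p}. p)
       \<le> (3 * N) ^ card (primes_mod3 2 (3 * N))"
proof -
  define A where "A = (\<Prod>m\<in>{..<N}. 3 * m + 2)"
  define B where "B = (\<Prod>m\<in>{..<N}. 3 * m + 1)"
  let ?P = "{p \<in> primes_mod3 1 (3 * N). 3 * N < 2 * p}"
  let ?Q = "primes_mod3 2 (3 * N)"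
  define e where "e q = multiplicity q A - multiplicity q B" for q
  have A0: "0 < A" and B0: "0 < B" unfolding A_def B_def by (auto intro!: prod_pos)
  have P0: "0 < \<Prod>?P" and Q0: "0 < (\<Prod>q\<in>?Q. q ^ e q)"
    by (auto intro!: prod_pos prime_gt_0_nat simp: primes_mod3_def)
  have excess: "q ^ e q \<le> 3 * N" if "prime q" for q
    unfolding e_def A_def B_def
    by (rule prime_power_excess_le[OF that])
       (use N in \<open>auto simp: card_multiples_2_mod_3_le_1_mod_3(1)[simplified]\<close>)
  have le_off_class: "multiplicity q A \<le> multiplicity q B" if q: "prime q" "q \<notin> ?Q" for q
  proof -
    consider "q = 3" | "q mod 3 = 1" | "q mod 3 = 2" "3 * N < q"
      using prime_mod_3_eq_0[OF q(1)] q by (fastforce simp: primes_mod3_def)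
    then show ?thesis
    proof cases
      case 1
      have "\<not> 3 dvd 3 * m + 2" for m :: nat by presburger
      then have "\<not> q dvd A"
        unfolding A_def using q(1) 1 by (subst prime_dvd_prod_iff) auto
      then show ?thesis by (simp add: not_dvd_imp_multiplicity_0)
    next
      case 2
      \<comment> \<open>Any exponent beyond which no power of \<open>q\<close> divides a factor will do; \<open>3 * N\<close> is one.\<close>
      have J: "x < q ^ Suc (3 * N)" if "x \<le> 3 * N" for x
        using that less_exp[of "Suc (3 * N)"] power_mono[of 2 q "Suc (3 * N)"] prime_ge_2_nat[OF q(1)]
        by linarith
      have "multiplicity q A = (\<Sum>j=1..3 * N. card {m \<in> {..<N}. q ^ j dvd 3 * m + 2})"
        unfolding A_def by (intro multiplicity_prod_eq_sum_card q J) auto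
      also have "\<dots> \<le> (\<Sum>j=1..3 * N. card {m \<in> {..<N}. q ^ j dvd 3 * m + 1})"
      proof (intro sum_mono card_multiples_2_mod_3_le_1_mod_3(2))
        show "q ^ j mod 3 = 1" for j using 2 power_mod[of q 3 j] by simp
      qed
      also have "\<dots> = multiplicity q B"
        unfolding B_def by (intro multiplicity_prod_eq_sum_card[symmetric] q J) auto
      finally show ?thesis .
    next
      case 3
      have "\<not> q dvd A"
        unfolding A_def using q(1) 3(2) by (subst prime_dvd_prod_iff) (auto dest!: dvd_imp_le)
      then show ?thesis by (simp add: not_dvd_imp_multiplicity_0)
    qed
  qed
  have upper_half: "multiplicity p A + 1 \<le> multiplicity p B" if p: "p \<in> ?P" for p
  proof -
    have pp: "prime p" "p mod 3 = 1" "p \<le> 3 * N" "3 * N < 2 * p"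
      using p by (auto simp: primes_mod3_def)
    have "\<not> p dvd A"
    proof
      assume "p dvd A"
      then obtain m where m: "m < N" "p dvd 3 * m + 2"
        unfolding A_def using pp(1) by (subst (asm) prime_dvd_prod_iff) auto
      then obtain t where t: "3 * m + 2 = p * t" by (elim dvdE)
      have "t < 2"
      proof (rule ccontr)
        assume "\<not> t < 2"
        then have "p * 2 \<le> p * t" by (intro mult_le_mono2) simp
        then show False using t m pp by linarith
      qed
      then have "t = 0 \<or> t = 1" by linarith
      then have "3 * m + 2 = p" using t by auto
      then show False using pp(2) by presburger
    qed
    moreover have "p dvd B"
    proof -
      have "p = 3 * (p div 3) + 1" using pp(2) by presburger
      moreover from this have "p div 3 < N" using pp(3) by linarith
      ultimately have "\<exists>m\<in>{..<N}. p dvd 3 * m + 1" by (metis dvd_refl lessThan_iff)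
      then show ?thesis unfolding B_def using pp(1) by (subst prime_dvd_prod_iff) auto
    qed
    then have "1 \<le> multiplicity p B"
      using B0 pp(1) by (intro multiplicity_geI) auto
    ultimately show ?thesis by (simp add: not_dvd_imp_multiplicity_0)
  qed
  have nonzero: "A \<noteq> 0" "\<Prod>?P \<noteq> 0" "B \<noteq> 0" "(\<Prod>q\<in>?Q. q ^ e q) \<noteq> 0"
    using A0 P0 B0 Q0 by (blast dest: less_imp_neq)+
  have "A * \<Prod>?P dvd B * (\<Prod>q\<in>?Q. q ^ e q)"
  proof (rule multiplicity_le_imp_dvd)
    show "A * \<Prod>?P \<noteq> 0" by (rule no_zero_divisors[OF nonzero(1,2)])
  next
    fix q :: nat assume q: "prime q"
    have "multiplicity q (\<Prod>p\<in>?P. p ^ 1) = (if q \<in> ?P then 1 else 0)"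
      by (rule multiplicity_prod_prime_powers[OF _ _ q]) (simp, simp add: primes_mod3_def)
    then have P: "multiplicity q (\<Prod>?P) = (if q \<in> ?P then 1 else 0)"
      by (simp only: power_one_right)
    have Q: "multiplicity q (\<Prod>q\<in>?Q. q ^ e q) = (if q \<in> ?Q then e q else 0)"
      by (rule multiplicity_prod_prime_powers[OF _ _ q]) (simp, simp add: primes_mod3_def)
    have AP: "multiplicity q (A * \<Prod>?P) = multiplicity q A + multiplicity q (\<Prod>?P)"
      by (intro prime_elem_multiplicity_mult_distrib prime_imp_prime_elem q nonzero)
    have BQ: "multiplicity q (B * (\<Prod>q\<in>?Q. q ^ e q)) = multiplicity q B + multiplicity q (\<Prod>q\<in>?Q. q ^ e q)"
      by (intro prime_elem_multiplicity_mult_distrib prime_imp_prime_elem q nonzero)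
    show "multiplicity q (A * \<Prod>?P) \<le> multiplicity q (B * (\<Prod>q\<in>?Q. q ^ e q))"
    proof (cases "q \<in> ?P")
      case True
      then show ?thesis unfolding AP BQ P using upper_half[OF True] by simp
    next
      case not_P: False
      show ?thesis
      proof (cases "q \<in> ?Q")
        case True
        then show ?thesis unfolding AP BQ P Q if_not_P[OF not_P] if_P[OF True]
          unfolding e_def by linarith
      next
        case False
        then show ?thesis unfolding AP BQ P if_not_P[OF not_P] using le_off_class[OF q] by simp
      qed
    qed
  qed
  then have "A * \<Prod>?P \<le> B * (\<Prod>q\<in>?Q. q ^ e q)"
    using B0 Q0 by (intro dvd_imp_le) auto
  also have "\<dots> \<le> A * (\<Prod>q\<in>?Q. 3 * N)"
    unfolding A_def B_def
    by (intro mult_mono prod_mono conjI excess) (auto simp: primes_mod3_def)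
  finally show ?thesis using A0 by simp
qed

text \<open>
  Each prime counted in the upper half is at least \<open>3 * M\<close>, and \<open>6 * M \<le> (3 * M)\<^sup>2\<close>; so the bound on
  their product becomes a bound on their number.
\<close>

lemma card_primes_1_mod_3_double:
  assumes "0 < M"
  shows "card (primes_mod3 1 (6 * M)) \<le> card (primes_mod3 1 (3 * M)) + 2 * card (primes_mod3 2 (6 * M))"
proof -
  let ?P = "{p \<in> primes_mod3 1 (6 * M). 6 * M < 2 * p}"
  let ?r = "card (primes_mod3 2 (6 * M))"
  have "(3 * M) ^ card ?P = (\<Prod>p\<in>?P. 3 * M)" by simp
  also have "\<dots> \<le> \<Prod>?P" by (intro prod_mono) auto
  also have "\<dots> \<le> (6 * M) ^ ?r"
    using prod_primes_1_mod_3_upper_half_le[of "2 * M"] assms by simp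
  also have "\<dots> \<le> ((3 * M) ^ 2) ^ ?r"
    using assms by (intro power_mono) (auto simp: power2_eq_square)
  also have "\<dots> = (3 * M) ^ (2 * ?r)" by (rule power_mult [symmetric])
  finally have "card ?P \<le> 2 * ?r"
    using assms by (subst (asm) power_increasing_iff) auto
  moreover have "primes_mod3 1 (6 * M) \<subseteq> primes_mod3 1 (3 * M) \<union> ?P"
    by (auto simp: primes_mod3_def)
  then have "card (primes_mod3 1 (6 * M)) \<le> card (primes_mod3 1 (3 * M) \<union> ?P)"
    by (intro card_mono) auto
  then have "card (primes_mod3 1 (6 * M)) \<le> card (primes_mod3 1 (3 * M)) + card ?P"
    using card_Un_le[of "primes_mod3 1 (3 * M)" ?P] by linarith
  ultimately show ?thesis by linarith
qed

lemma card_primes_1_mod_3_le: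
  "card (primes_mod3 1 (3 * 2 ^ j)) \<le> 2 * j * card (primes_mod3 2 (3 * 2 ^ j))"
proof (induction j)
  case 0
  have "p mod 3 \<noteq> 1" if "prime p" "p \<le> 3" for p :: nat
    using that prime_ge_2_nat[of p] by presburger
  then have "primes_mod3 1 3 = {}" unfolding primes_mod3_def by blast
  then show ?case by simp
next
  case (Suc j)
  have "card (primes_mod3 1 (3 * 2 ^ Suc j)) \<le>
        card (primes_mod3 1 (3 * 2 ^ j)) + 2 * card (primes_mod3 2 (3 * 2 ^ Suc j))"
    using card_primes_1_mod_3_double[of "2 ^ j"] by simp
  also have "\<dots> \<le> 2 * j * card (primes_mod3 2 (3 * 2 ^ j)) + 2 * card (primes_mod3 2 (3 * 2 ^ Suc j))"
    using Suc.IH by simp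
  also have "\<dots> \<le> 2 * j * card (primes_mod3 2 (3 * 2 ^ Suc j)) + 2 * card (primes_mod3 2 (3 * 2 ^ Suc j))"
    by (intro add_mono mult_left_mono card_primes_mod3_mono) auto
  finally show ?case by (simp add: algebra_simps)
qed

lemma cubic_lt_exponential:
  fixes j :: nat
  assumes "10 \<le> j"
  shows "(j + 2) * (2 + (j + 2) * (2 * j + 1)) < 3 * 2 ^ j"
  using assms
proof (induction j rule: dec_induct)
  case (step j)
  have "10 * j \<le> j * j" using step.hyps by simp
  have "(Suc j + 2) * (2 + (Suc j + 2) * (2 * Suc j + 1)) = 2 * (j * j * j) + 15 * (j * j) + 38 * j + 33"
    by (simp add: algebra_simps)
  also have "\<dots> \<le> 4 * (j * j * j) + 18 * (j * j) + 28 * j + 16"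
    using step.hyps \<open>10 * j \<le> j * j\<close> by linarith
  also have "\<dots> = 2 * ((j + 2) * (2 + (j + 2) * (2 * j + 1)))"
    by (simp add: algebra_simps)
  also have "\<dots> < 3 * 2 ^ Suc j" using step.IH by simp
  finally show ?case .
qed simp

text \<open>
  If there were only \<open>r \<le> j + 2\<close> primes that are 2 modulo 3 up to \<open>x = 3 * 2 ^ j\<close>, then at most
  \<open>1 + r + 2 * j * r\<close> primes altogether. Chebyshev's bound and \<open>x \<le> 2 ^ (j + 2)\<close> would then bound
  \<open>x\<close> by a cubic polynomial in \<open>j\<close>, which the exponential exceeds from \<open>j = 10\<close> on.
\<close>

lemma card_primes_2_mod_3_ge:
  assumes j: "10 \<le> j"
  shows "j + 3 \<le> card (primes_mod3 2 (3 * 2 ^ j))"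
proof (rule ccontr)
  let ?x = "3 * 2 ^ j :: nat"
  let ?r = "card (primes_mod3 2 ?x)"
  assume "\<not> ?thesis"
  then have r: "?r \<le> j + 2" by simp
  obtain i where i: "j = Suc i" using j by (cases j) auto
  have card: "card {p. prime p \<and> p \<le> ?x} + 1 \<le> 2 + ?r * (2 * j + 1)"
    using card_primes_le[of ?x] card_primes_1_mod_3_le[of j] by (simp add: algebra_simps)
  define h :: nat where "h = 3 * 2 ^ i"
  have h: "?x = 2 * h" by (simp add: i h_def)
  have "(2::nat) ^ ?x = (2 ^ 2) ^ h" by (simp only: h power_mult)
  also have "\<dots> = 4 ^ h" by simp
  also have "\<dots> \<le> (2 * h) ^ (card {p. prime p \<and> p \<le> 2 * h} + 1)"
    by (rule four_power_le_power_card_primes) (simp add: h_def)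
  also have "2 * h = ?x" by (rule h [symmetric])
  also have "?x ^ (card {p. prime p \<and> p \<le> ?x} + 1) \<le> ?x ^ (2 + ?r * (2 * j + 1))"
    by (intro power_increasing card) (simp add: Suc_leI)
  also have "\<dots> \<le> (2 ^ (j + 2)) ^ (2 + ?r * (2 * j + 1))"
    by (intro power_mono) auto
  also have "\<dots> = 2 ^ ((j + 2) * (2 + ?r * (2 * j + 1)))" by (rule power_mult [symmetric])
  finally have "?x \<le> (j + 2) * (2 + ?r * (2 * j + 1))"
    by (subst (asm) power_increasing_iff) auto
  also have "\<dots> \<le> (j + 2) * (2 + (j + 2) * (2 * j + 1))"
    using r by (intro mult_left_mono add_left_mono mult_right_mono) auto
  finally show False using cubic_lt_exponential[OF j] by linarith
qed

text \<open>
  The cut at \<open>3072 = 3 * 2 ^ 10\<close> is where the asymptotic bound starts to apply. Below it \<open>k \<le> 7\<close>,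
  and a list of seven small primes suffices. Above it, for \<open>n - 1\<close> between \<open>3 * 2 ^ j\<close> and
  \<open>3 * 2 ^ (j + 1)\<close>, already \<open>2 ^ k \<le> n\<close> gives \<open>k \<le> j + 3\<close>.
\<close>

lemma card_primes_2_mod_3_ge_log3:
  assumes "3 ^ k \<le> n"
  shows "k \<le> card (primes_mod3 2 (n - 1))"
proof (cases "n \<le> 3072")
  case True
  have list: "k \<le> card (primes_mod3 2 (n - 1))"
    if "distinct ps" "k \<le> length ps" "\<forall>p\<in>set ps. prime p \<and> p < 3 ^ k \<and> p mod 3 = 2" for ps :: "nat list"
  proof -
    have "p \<in> primes_mod3 2 (n - 1)" if "p \<in> set ps" for p
    proof -
      have p: "prime p" "p < 3 ^ k" "p mod 3 = 2" using that \<open>\<forall>p\<in>set ps. _\<close> by blast+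
      have "p \<le> n - 1" using p(2) assms by linarith
      with p show ?thesis by (simp add: primes_mod3_def)
    qed
    then have "card (set ps) \<le> card (primes_mod3 2 (n - 1))" by (intro card_mono) auto
    then show ?thesis using that by (simp add: distinct_card)
  qed
  have primes: "prime (2::nat)" "prime (5::nat)" "prime (11::nat)" "prime (17::nat)"
    "prime (23::nat)" "prime (29::nat)" "prime (41::nat)" by simp_all
  have "k < 8"
  proof (rule ccontr)
    assume "\<not> k < 8"
    then have "(3::nat) ^ 8 \<le> 3 ^ k" by (intro power_increasing) auto
    with assms True show False by simp
  qed
  then consider "k = 0" | "k = 1" | "k = 2" | "k = 3" | "4 \<le> k" "k \<le> 7" by linarith
  then show ?thesis
  proof cases
    case 2 then show ?thesis by (intro list[of "[2]"]) (simp_all add: primes)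
  next
    case 3 then show ?thesis by (intro list[of "[2,5]"]) (simp_all add: primes)
  next
    case 4 then show ?thesis by (intro list[of "[2,5,11]"]) (simp_all add: primes)
  next
    case 5
    then have "(3::nat) ^ 4 \<le> 3 ^ k" by (intro power_increasing) auto
    with 5 show ?thesis by (intro list[of "[2,5,11,17,23,29,41]"]) (simp_all add: primes)
  qed simp
next
  case False
  define q where "q = (n - 1) div 3"
  have q: "3 * q \<le> n - 1" "n \<le> 3 * (q + 1)" "1024 \<le> q"
    using False unfolding q_def by presburger+
  obtain j where j: "2 ^ j \<le> q" "q < 2 ^ (j + 1)"
    using ex_power_ivl1[of 2 q] q(3) by auto
  have "(2::nat) ^ 10 < 2 ^ (j + 1)" using j(2) q(3) by simp
  then have "10 < j + 1" by (rule power_less_imp_less_exp[rotated]) simp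
  then have j10: "10 \<le> j" by simp
  have "3 * (q + 1) \<le> 3 * 2 ^ (j + 1)"
    using j(2) by (intro mult_le_mono2) simp
  with q(2) have "n \<le> 3 * 2 ^ (j + 1)" by (rule order_trans)
  also have "\<dots> \<le> 2 ^ (j + 3)" by (simp add: power_add)
  finally have "(2::nat) ^ k \<le> 2 ^ (j + 3)"
    using assms power_mono[of 2 "3::nat" k] by linarith
  then have "k \<le> j + 3" by (subst (asm) power_increasing_iff) auto
  also have "\<dots> \<le> card (primes_mod3 2 (3 * 2 ^ j))" by (rule card_primes_2_mod_3_ge[OF j10])
  also have "\<dots> \<le> card (primes_mod3 2 (n - 1))"
    using j(1) q(1) by (intro card_primes_mod3_mono) linarith
  finally show ?thesis .
qed

section \<open>Divisibility of the sequence\<close>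

lemma a_eq_mult: "2 \<le> n \<Longrightarrow> a n = a (n - 1) * (n div gcd n (a (n - 1)) + 1)"
proof -
  assume n: "2 \<le> n"
  let ?g = "gcd n (a (n - 1))"
  have "lcm n (a (n - 1)) = a (n - 1) * (n div ?g)"
    unfolding lcm_nat_def by (metis dvd_div_mult gcd_dvd1 mult.commute)
  then show ?thesis using a_rec[OF n] by simp
qed

lemma even_a: "3 \<le> n \<Longrightarrow> even (a n)"
proof (induction n rule: dec_induct)
  case base
  have "a 2 = 3" using a_rec[of 2] by simp
  then have "a 3 = 6" using a_rec[of 3] by simp
  then show ?case by simp
next
  case (step n)
  then show ?case using a_dvd[of "Suc n"] by (auto intro: dvd_trans)
qed

text \<open>
  \<open>a m\<close> is a product of numbers \<open>b i + 1\<close> with \<open>i \<le> m\<close>, and \<open>b i\<close> is a divisor of \<open>i\<close>. So \<open>p\<close> could only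
  enter at \<open>i = p - 1\<close> with \<open>b i = i\<close>, that is with \<open>i\<close> coprime to \<open>a (i - 1)\<close>; but both are
  even.
\<close>

lemma prime_not_dvd_a:
  assumes p: "prime p" "5 \<le> p" and m: "1 \<le> m" "m < p"
  shows "\<not> p dvd a m"
  using m
proof (induction m rule: dec_induct)
  case base
  show ?case using p by auto
next
  case (step m)
  let ?q = "Suc m div gcd (Suc m) (a m)"
  have "\<not> p dvd ?q + 1"
  proof
    assume "p dvd ?q + 1"
    then have "p \<le> ?q + 1" by (intro dvd_imp_le) auto
    moreover have "?q \<le> Suc m" by (rule div_le_dividend)
    ultimately have q: "?q = Suc m" "p = Suc m + 1" using step.prems by linarith+
    have "odd p" using p by (intro prime_odd_nat) auto
    then have "even (Suc m)" using q by simp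
    moreover have "even (a m)" using q p by (intro even_a) simp
    ultimately have "2 dvd gcd (Suc m) (a m)" by simp
    then have "2 \<le> gcd (Suc m) (a m)" by (intro dvd_imp_le) auto
    then have "?q < Suc m" by (intro div_less_dividend) auto
    with q show False by simp
  qed
  moreover have "a (Suc m) = a m * (?q + 1)"
    using a_eq_mult[of "Suc m"] step.hyps by simp
  moreover have "\<not> p dvd a m" using step.IH step.prems by simp
  ultimately show ?case using p(1) by (simp only: prime_dvd_mult_iff simp_thms)
qed

lemma three_power_dvd_a:
  assumes "1 \<le> m"
  shows "3 ^ card (primes_mod3 2 m) dvd a m"
  using assms
proof (induction m rule: dec_induct)
  case base
  have "primes_mod3 2 1 = {}" by (auto simp: primes_mod3_def dest: prime_ge_2_nat)
  then show ?case by simp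
next
  case (step m)
  show ?case
  proof (cases "prime (Suc m) \<and> Suc m mod 3 = 2")
    case True
    then have "primes_mod3 2 (Suc m) = insert (Suc m) (primes_mod3 2 m)"
      by (auto simp: primes_mod3_def le_Suc_eq)
    moreover have "Suc m \<notin> primes_mod3 2 m" by (simp add: primes_mod3_def)
    ultimately have card: "card (primes_mod3 2 (Suc m)) = Suc (card (primes_mod3 2 m))" by simp
    have "\<not> Suc m dvd a m"
    proof (cases "5 \<le> Suc m")
      case True
      then show ?thesis using \<open>prime (Suc m) \<and> _\<close> step.hyps by (intro prime_not_dvd_a) auto
    next
      case False
      then have "m = 1 \<or> m = 2 \<or> m = 3" using step.hyps by linarith
      then show ?thesis using \<open>prime (Suc m) \<and> _\<close> by (elim disjE) (simp_all add: numeral_2_eq_2)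
    qed
    then have "coprime (Suc m) (a m)" by (rule prime_imp_coprime[OF conjunct1[OF True]])
    then have "gcd (Suc m) (a m) = 1" by (rule coprime_imp_gcd_eq_1)
    then have "a (Suc m) = (Suc m + 1) * a m"
      using a_eq_mult[of "Suc m"] step.hyps by simp
    moreover have "3 dvd Suc m + 1" using conjunct2[OF True] by presburger
    ultimately show ?thesis
      unfolding card using step.IH by (simp only: power_Suc mult_dvd_mono)
  next
    case False
    then have "primes_mod3 2 (Suc m) = primes_mod3 2 m"
      by (auto simp: primes_mod3_def le_Suc_eq)
    then show ?thesis
      using step.IH a_dvd[of "Suc m"] step.hyps dvd_trans by simp
  qed
qed

theorem proposition6:
  fixes n :: nat
  assumes "n \<ge> 2"
  shows "b n \<noteq> 3"
proof
  assume b3: "b n = 3"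
  define g where "g = gcd n (a (n - 1))"
  define k where "k = multiplicity 3 n"
  have a0: "0 < a (n - 1)" using assms by (intro a_pos) simp
  have "b n = of_nat (n div g)"
    unfolding b_def a_eq_mult[OF assms] g_def using a0 by (simp add: field_simps)
  with b3 have "n div g = 3" by (metis of_nat_eq_iff of_nat_numeral)
  then have n: "n = 3 * g" unfolding g_def by (metis dvd_div_mult_self gcd_dvd1)
  have kn: "3 ^ k dvd n" unfolding k_def by (rule multiplicity_dvd)
  then have "3 ^ k \<le> n" using assms by (intro dvd_imp_le) auto
  then have k: "k \<le> card (primes_mod3 2 (n - 1))" by (rule card_primes_2_mod_3_ge_log3)
  have "3 ^ card (primes_mod3 2 (n - 1)) dvd a (n - 1)"
    using assms by (intro three_power_dvd_a) simp
  then have "3 ^ k dvd a (n - 1)" using k by (rule power_le_dvd)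
  with kn have "3 ^ k dvd g" unfolding g_def by simp
  then have "3 ^ Suc k dvd n" unfolding n by simp
  then have "Suc k \<le> multiplicity 3 n" using assms by (intro multiplicity_geI) auto
  then show False by (simp add: k_def)
qed

end
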